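(* Let $1<p,q<\infty$ with $\frac1p+\frac1q=1$, $0<\alpha<1$, let $f_0\in L^p(\Omega)$ be nonnegative, and let $\mathcal{P}$ be a Perron-Frobenius operator with $\|\mathcal{P}f\|_{L^p}\le\|f\|_{L^p}$ for all $f\in L^p(\Omega)$. Put $b(u,v)=\int_\Omega(u-\alpha\mathcal{P}u)\,v\,d\mu$ and $l(v)=\int_\Omega f_0v\,d\mu$ for $u\in L^p(\Omega)$, $v\in L^q(\Omega)$. Then: (1) (Boundedness of $b$) $|b(u,v)|\le(1+\alpha)\|u\|_{L^p}\|v\|_{L^q}$ for all $u\in L^p(\Omega)$, $v\in L^q(\Omega)$; (2) (Boundedness of $l$) $|l(v)|\le\|f_0\|_{L^p}\|v\|_{L^q}$ for all $v\in L^q(\Omega)$; (3) (Inf-sup stability) $\sup_{0\ne v\in L^q(\Omega)}\frac{b(u,v)}{\|v\|_{L^q}}\ge(1-\alpha)\|u\|_{L^p}$ for all $u\in L^p(\Omega)$; (4) (Adjoint injectivity) if $v\in L^q(\Omega)$ satisfies $b(u,v)=0$ for all $u\in L^p(\Omega)$, then $v=0$. Hence the problem: find $u\in L^p(\Omega)$ such that $b(u,v)=l(v)$ for all $v\in L^q(\Omega)$, has a unique solution.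
   Context: All functions are real-valued. $\Omega$ is a bounded (Borel) subset of $\mathbb{R}^d$, $d\ge1$, with Borel sigma-algebra $\mathcal{B}$ and Lebesgue measure $\mu$. $S:\Omega\to\Omega$ is a map (measurable and nonsingular, i.e. $\mu(S^{-1}(A))=0$ whenever $\mu(A)=0$, so that the following is well defined). The Perron-Frobenius operator associated with $S$ is the linear operator $\mathcal{P}:L^1(\Omega)\to L^1(\Omega)$ such that $\int_A\mathcal{P}f\,d\mu=\int_{S^{-1}(A)}f\,d\mu$ for all $A\in\mathcal{B}$ and $f\in L^1(\Omega)$. Since $\Omega$ is bounded, $L^p(\Omega)\subset L^1(\Omega)$; it is assumed that $\mathcal{P}$ is non-expansive on $L^p(\Omega)$, i.e. for all $f\in L^p(\Omega)$, $\mathcal{P}f\in L^p(\Omega)$ and $\|\mathcal{P}f\|_{L^p}\le\|f\|_{L^p}$. *)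

theory Defs
  imports "HOL-Analysis.Analysis"
begin

text \<open>
  Elements of \<open>L\<^sup>p\<close> are represented by measurable functions; equality in \<open>L\<^sup>p\<close> is equality
  almost everywhere.
\<close>

definition Lp_fun :: "'a measure \<Rightarrow> real \<Rightarrow> ('a \<Rightarrow> real) set" where
  "Lp_fun M p = {f \<in> borel_measurable M. integrable M (\<lambda>x. \<bar>f x\<bar> powr p)}"

definition Lp_norm :: "'a measure \<Rightarrow> real \<Rightarrow> ('a \<Rightarrow> real) \<Rightarrow> real" where
  "Lp_norm M p f = (\<integral>x. \<bar>f x\<bar> powr p \<partial>M) powr (1 / p)"

definition nonsingular_map :: "'a measure \<Rightarrow> ('a \<Rightarrow> 'a) \<Rightarrow> bool" where
  "nonsingular_map M S \<longleftrightarrow>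
     S \<in> measurable M M \<and>
     (\<forall>A\<in>sets M. emeasure M A = 0 \<longrightarrow> emeasure M (S -` A \<inter> space M) = 0)"

text \<open>
  \<open>P\<close> picks a representative of the image class. Compatibility with almost-everywhere equality
  is not listed, since for nonsingular \<open>S\<close> the integral identity determines \<open>P f\<close>
  almost everywhere from the class of \<open>f\<close>.
\<close>

definition perron_frobenius ::
    "'a measure \<Rightarrow> ('a \<Rightarrow> 'a) \<Rightarrow> (('a \<Rightarrow> real) \<Rightarrow> 'a \<Rightarrow> real) \<Rightarrow> bool" where
  "perron_frobenius M S P \<longleftrightarrow>
     (\<forall>f. integrable M f \<longrightarrow> integrable M (P f)) \<and>
     (\<forall>f g. integrable M f \<longrightarrow> integrable M g \<longrightarrow>
        (AE x in M. P (\<lambda>y. f y + g y) x = P f x + P g x)) \<and>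
     (\<forall>c f. integrable M f \<longrightarrow> (AE x in M. P (\<lambda>y. c * f y) x = c * P f x)) \<and>
     (\<forall>f. integrable M f \<longrightarrow>
        (\<forall>A\<in>sets M. (LINT x:A|M. P f x) = (LINT x:(S -` A \<inter> space M)|M. f x)))"

definition pf_bilinear ::
    "'a measure \<Rightarrow> real \<Rightarrow> (('a \<Rightarrow> real) \<Rightarrow> 'a \<Rightarrow> real) \<Rightarrow> ('a \<Rightarrow> real) \<Rightarrow> ('a \<Rightarrow> real) \<Rightarrow> real" where
  "pf_bilinear M \<alpha> P u v = (\<integral>x. (u x - \<alpha> * P u x) * v x \<partial>M)"

definition pf_linear :: "'a measure \<Rightarrow> ('a \<Rightarrow> real) \<Rightarrow> ('a \<Rightarrow> real) \<Rightarrow> real" where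
  "pf_linear M f0 v = (\<integral>x. f0 x * v x \<partial>M)"

text \<open>
  The supremum of \<open>F v / \<parallel>v\<parallel>\<close> over nonzero \<open>v\<close> in \<open>L\<^sup>q\<close>. If the measure vanishes then
  \<open>L\<^sup>q = {0}\<close> and the supremum is over the empty set; it is then read as \<open>0\<close>, as is usual
  for operator norms, instead of the \<open>ereal\<close> value \<open>-\<infinity>\<close>.
\<close>

definition Lq_sup_quotient :: "'a measure \<Rightarrow> real \<Rightarrow> (('a \<Rightarrow> real) \<Rightarrow> real) \<Rightarrow> ereal" where
  "Lq_sup_quotient M q F =
     (let V = {v \<in> Lp_fun M q. \<not> (AE x in M. v x = 0)}
      in if V = {} then 0 else (SUP v\<in>V. ereal (F v / Lp_norm M q v)))"

end

theory Submission
  imports Defs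
begin

text \<open>
  Inf-sup stability and uniqueness follow by testing with the duality map
  \<open>v = sgn u \<bar>u\<bar>\<^sup>p\<^sup>-\<^sup>1\<close>, for which \<open>\<integral> u v = \<parallel>u\<parallel>\<^sub>p \<parallel>v\<parallel>\<^sub>q\<close> while
  \<open>\<bar>\<integral> (P u) v\<bar> \<le> \<parallel>u\<parallel>\<^sub>p \<parallel>v\<parallel>\<^sub>q\<close> by contractivity. Existence comes from the Neumann series
  \<open>u = \<Sum>n. \<alpha>\<^sup>n P\<^sup>n g\<close>. It converges almost everywhere to an \<open>L\<^sup>p\<close> function by Jensen's
  inequality for the weights \<open>(1 - \<alpha>) \<alpha>\<^sup>n\<close>, and \<open>u = g + \<alpha> P u\<close> is checked by integrating
  over an arbitrary measurable set, using the integral identity that defines \<open>P\<close>; thus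
  neither completeness of \<open>L\<^sup>p\<close> nor Minkowski's inequality is needed. Adjoint
  injectivity follows by solving \<open>u - \<alpha> P u = sgn v \<bar>v\<bar>\<^sup>q\<^sup>-\<^sup>1\<close>.
\<close>

section \<open>Lebesgue spaces\<close>

lemma Lp_funD:
  assumes "f \<in> Lp_fun M p"
  shows "f \<in> borel_measurable M" "integrable M (\<lambda>x. \<bar>f x\<bar> powr p)"
  using assms by (auto simp: Lp_fun_def)

lemma Lp_norm_nonneg: "0 \<le> Lp_norm M p f"
  by (simp add: Lp_norm_def)

lemma Lp_norm_powr:
  assumes "0 < p"
  shows "Lp_norm M p f powr p = (\<integral>x. \<bar>f x\<bar> powr p \<partial>M)"
  using assms by (simp add: Lp_norm_def powr_powr)

lemma Lp_norm_zero_AE: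
  assumes "f \<in> Lp_fun M p" "0 < p" "Lp_norm M p f = 0"
  shows "AE x in M. f x = 0"
proof -
  have "(\<integral>x. \<bar>f x\<bar> powr p \<partial>M) = 0"
    using Lp_norm_powr[OF assms(2), of M f] assms by simp
  then have "AE x in M. \<bar>f x\<bar> powr p = 0"
    by (subst (asm) integral_nonneg_eq_0_iff_AE) (auto intro: Lp_funD[OF assms(1)])
  then show ?thesis by simp
qed

lemma Lp_fun_cmult:
  assumes "f \<in> Lp_fun M p"
  shows "(\<lambda>x. c * f x) \<in> Lp_fun M p"
  using Lp_funD[OF assms] by (auto simp: Lp_fun_def abs_mult powr_mult)

text \<open>Bounding the sum by twice the larger term gives a crude constant without convexity. That
  suffices for closure of L^p under addition, where only integrability matters.\<close>

lemma abs_add_powr_le: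
  fixes a b p :: real
  assumes "0 < p"
  shows "\<bar>a + b\<bar> powr p \<le> 2 powr p * (\<bar>a\<bar> powr p + \<bar>b\<bar> powr p)"
proof -
  have "\<bar>a + b\<bar> powr p \<le> (2 * max \<bar>a\<bar> \<bar>b\<bar>) powr p"
    using assms by (intro powr_mono2) auto
  also have "\<dots> = 2 powr p * max \<bar>a\<bar> \<bar>b\<bar> powr p"
    by (subst powr_mult) auto
  also have "\<dots> \<le> 2 powr p * (\<bar>a\<bar> powr p + \<bar>b\<bar> powr p)"
    by (intro mult_left_mono) (auto simp: max_def)
  finally show ?thesis .
qed

lemma Lp_fun_add:
  assumes f: "f \<in> Lp_fun M p" and g: "g \<in> Lp_fun M p" and "0 < p"
  shows "(\<lambda>x. f x + g x) \<in> Lp_fun M p"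
proof -
  note [measurable] = Lp_funD(1)[OF f] Lp_funD(1)[OF g]
  have "integrable M (\<lambda>x. \<bar>f x + g x\<bar> powr p)"
  proof (rule Bochner_Integration.integrable_bound)
    show "integrable M (\<lambda>x. 2 powr p * (\<bar>f x\<bar> powr p + \<bar>g x\<bar> powr p))"
      using Lp_funD(2)[OF f] Lp_funD(2)[OF g] by simp
  qed (use abs_add_powr_le[OF assms(3)] in auto)
  then show ?thesis by (simp add: Lp_fun_def)
qed

text \<open>Split at absolute value 1. On a finite measure space the right side is integrable, so
  L^p embeds in L^1, where \<open>P\<close> is defined; the same bound later controls the L^1 size
  of the Neumann iterates.\<close>

lemma abs_le_one_add_powr:
  fixes a p :: real
  assumes "1 \<le> p"
  shows "\<bar>a\<bar> \<le> 1 + \<bar>a\<bar> powr p"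
  using powr_mono[of 1 p "\<bar>a\<bar>"] assms
  by (cases "\<bar>a\<bar> \<le> 1") (auto simp: add_increasing2)

lemma (in finite_measure) Lp_fun_integrable:
  assumes f: "f \<in> Lp_fun M p" and "1 \<le> p"
  shows "integrable M f"
proof (rule Bochner_Integration.integrable_bound)
  show "integrable M (\<lambda>x. 1 + \<bar>f x\<bar> powr p)"
    using Lp_funD(2)[OF f] by simp
  show "AE x in M. norm (f x) \<le> norm (1 + \<bar>f x\<bar> powr p)"
    using abs_le_one_add_powr[OF assms(2)] by auto
qed (rule Lp_funD[OF f])

lemma Holder_inequality:
  assumes pq: "1 < p" "1 < q" "1 / p + 1 / q = 1"
    and f: "f \<in> Lp_fun M p" and g: "g \<in> Lp_fun M q"
  shows "integrable M (\<lambda>x. f x * g x)"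
    and "\<bar>\<integral>x. f x * g x \<partial>M\<bar> \<le> Lp_norm M p f * Lp_norm M q g"
proof -
  note [measurable] = Lp_funD(1)[OF f] Lp_funD(1)[OF g]
  have young: "\<bar>a * b\<bar> \<le> \<bar>a\<bar> powr p / p + \<bar>b\<bar> powr q / q" for a b :: real
    using Youngs_inequality[OF pq, of "\<bar>a\<bar>" "\<bar>b\<bar>"] by (simp add: abs_mult)
  show int: "integrable M (\<lambda>x. f x * g x)"
  proof (rule Bochner_Integration.integrable_bound)
    show "integrable M (\<lambda>x. \<bar>f x\<bar> powr p / p + \<bar>g x\<bar> powr q / q)"
      using Lp_funD(2)[OF f] Lp_funD(2)[OF g] by simp
    show "AE x in M. norm (f x * g x) \<le> norm (\<bar>f x\<bar> powr p / p + \<bar>g x\<bar> powr q / q)"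
      using young order_trans[OF _ abs_ge_self] by (intro AE_I2) (simp only: real_norm_def, blast)
  qed simp
  define A where "A = Lp_norm M p f"
  define B where "B = Lp_norm M q g"
  show "\<bar>\<integral>x. f x * g x \<partial>M\<bar> \<le> Lp_norm M p f * Lp_norm M q g"
  \<comment> \<open>The normalisation below divides by both norms. If one of them vanishes, the
    product is zero almost everywhere.\<close>
  proof (cases "A = 0 \<or> B = 0")
    case True
    then have "AE x in M. f x * g x = 0"
    proof
      assume "A = 0"
      then have "AE x in M. f x = 0"
        using Lp_norm_zero_AE[OF f] pq by (simp add: A_def)
      then show ?thesis by eventually_elim simp
    next
      assume "B = 0"
      then have "AE x in M. g x = 0"
        using Lp_norm_zero_AE[OF g] pq by (simp add: B_def)
      then show ?thesis by eventually_elim simp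
    qed
    then have "(\<integral>x. f x * g x \<partial>M) = 0" by (rule integral_eq_zero_AE)
    then show ?thesis by (simp add: Lp_norm_nonneg)
  next
    case False
    then have AB: "0 < A" "0 < B"
      using Lp_norm_nonneg[of M p f] Lp_norm_nonneg[of M q g] by (auto simp: A_def B_def)
    \<comment> \<open>Young's inequality for \<open>f x / A\<close> and \<open>g x / B\<close>,
      scaled back by \<open>A * B\<close>; the integral of this majorant is
      \<open>A * B * (1 / p + 1 / q)\<close>.\<close>
    let ?h = "\<lambda>x. A * B * (\<bar>f x\<bar> powr p / (A powr p * p) + \<bar>g x\<bar> powr q / (B powr q * q))"
    have le: "\<bar>f x * g x\<bar> \<le> ?h x" for x
    proof -
      have "\<bar>f x * g x\<bar> = A * B * \<bar>(f x / A) * (g x / B)\<bar>"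
        using AB by (simp add: abs_mult)
      also have "\<dots> \<le> A * B * (\<bar>f x / A\<bar> powr p / p + \<bar>g x / B\<bar> powr q / q)"
        using AB by (intro mult_left_mono young) auto
      also have "\<dots> = ?h x"
        using AB by (simp add: powr_divide)
      finally show ?thesis .
    qed
    have "\<bar>\<integral>x. f x * g x \<partial>M\<bar> \<le> (\<integral>x. \<bar>f x * g x\<bar> \<partial>M)"
      by (rule integral_abs_bound)
    also have "\<dots> \<le> (\<integral>x. ?h x \<partial>M)"
      using int Lp_funD(2)[OF f] Lp_funD(2)[OF g] le by (intro integral_mono) auto
    also have "\<dots> = A * B * ((\<integral>x. \<bar>f x\<bar> powr p \<partial>M) / (A powr p * p) +
        (\<integral>x. \<bar>g x\<bar> powr q \<partial>M) / (B powr q * q))"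
      using Lp_funD(2)[OF f] Lp_funD(2)[OF g] by simp
    also have "\<dots> = A * B * (1 / p + 1 / q)"
      using AB pq by (simp add: A_def B_def Lp_norm_powr[symmetric])
    finally show ?thesis
      using pq by (simp add: A_def B_def)
  qed
qed

section \<open>The duality map from L^p to L^q\<close>

text \<open>The gradient of \<open>\<bar>u\<bar> powr p / p\<close> for p > 1. Left unnormalised, it
  involves no division by the norm of \<open>u\<close>.\<close>

definition duality_map :: "real \<Rightarrow> ('a \<Rightarrow> real) \<Rightarrow> 'a \<Rightarrow> real" where
  "duality_map p u = (\<lambda>x. sgn (u x) * \<bar>u x\<bar> powr (p - 1))"

lemma mult_duality_map: "u x * duality_map p u x = \<bar>u x\<bar> powr p"
proof (cases "u x = 0")
  case False
  have "u x * duality_map p u x = \<bar>u x\<bar> powr 1 * \<bar>u x\<bar> powr (p - 1)"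
    using False by (simp add: duality_map_def sgn_if)
  then show ?thesis by (simp only: powr_add[symmetric]) simp
qed (simp add: duality_map_def)

lemma abs_duality_map_powr:
  assumes "1 < p" "1 / p + 1 / q = (1::real)"
  shows "\<bar>duality_map p u x\<bar> powr q = \<bar>u x\<bar> powr p"
proof -
  have "(p - 1) * q = p"
    using assms by (cases "q = 0") (auto simp: field_simps)
  then show ?thesis
    by (cases "u x = 0") (auto simp: duality_map_def abs_mult powr_powr)
qed

lemma duality_map_Lp_fun:
  assumes "1 < p" "1 / p + 1 / q = (1::real)" and u: "u \<in> Lp_fun M p"
  shows "duality_map p u \<in> Lp_fun M q"
proof -
  note [measurable] = Lp_funD(1)[OF u]
  have "duality_map p u \<in> borel_measurable M"
    unfolding duality_map_def by measurable
  then show ?thesis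
    using Lp_funD(2)[OF u] by (simp add: Lp_fun_def abs_duality_map_powr[OF assms(1,2)])
qed

text \<open>The equality case of Hoelder: both norms are powers of the same integral, with exponents
  1/p and 1/q adding up to 1.\<close>

lemma Lp_norm_duality_map:
  assumes "1 < p" "1 / p + 1 / q = (1::real)"
  shows "Lp_norm M p u * Lp_norm M q (duality_map p u) = (\<integral>x. \<bar>u x\<bar> powr p \<partial>M)"
proof -
  define I where "I = (\<integral>x. \<bar>u x\<bar> powr p \<partial>M)"
  have "I \<ge> 0" by (simp add: I_def)
  then have "I powr (1 / p) * I powr (1 / q) = I"
    using assms by (simp flip: powr_add)
  then show ?thesis
    using assms by (simp add: Lp_norm_def abs_duality_map_powr I_def)
qed

section \<open>Geometrically weighted series\<close>

text \<open>Jensen's inequality for the probability weights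
  \<open>(1 - \<alpha>) * \<alpha> ^ n\<close>: average the tangent inequality at the mean
  \<open>t\<close>, where the linear part contributes exactly \<open>p * t powr p\<close>.\<close>

lemma powr_geometric_suminf_le:
  fixes a :: "nat \<Rightarrow> real"
  assumes pq: "1 < p" "1 < q" "1 / p + 1 / q = 1" and \<alpha>: "0 < \<alpha>" "\<alpha> < 1"
    and a: "\<And>n. 0 \<le> a n" and sa: "summable (\<lambda>n. \<alpha> ^ n * a n)"
    and sp: "summable (\<lambda>n. \<alpha> ^ n * a n powr p)"
  shows "((1 - \<alpha>) * (\<Sum>n. \<alpha> ^ n * a n)) powr p \<le> (1 - \<alpha>) * (\<Sum>n. \<alpha> ^ n * a n powr p)"
proof -
  define t where "t = (1 - \<alpha>) * (\<Sum>n. \<alpha> ^ n * a n)"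
  have t: "0 \<le> t"
    using \<alpha> a sa by (auto simp: t_def intro!: mult_nonneg_nonneg suminf_nonneg)
  have pq': "(p - 1) * q = p" "p / q = p - 1"
    using pq by (auto simp: field_simps)
  \<comment> \<open>At \<open>t = 0\<close> both sides vanish, since \<open>powr\<close> with base 0
    is 0.\<close>
  have tp: "t * t powr (p - 1) = t powr p"
    using t powr_add[of t 1 "p - 1"] by (cases "t = 0") auto
  \<comment> \<open>Young's inequality puts the graph of \<open>x\<^sup>p\<close> above its tangent at \<open>t\<close>.\<close>
  have tangent: "p * (a n * t powr (p - 1)) \<le> a n powr p + (p - 1) * t powr p" for n
  proof -
    have "a n * t powr (p - 1) \<le> a n powr p / p + t powr p / q"
      using Youngs_inequality[OF pq a[of n], of "t powr (p - 1)"] pq' by (simp add: powr_powr)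
    then have "p * (a n * t powr (p - 1)) \<le> p * (a n powr p / p + t powr p / q)"
      using pq by (intro mult_left_mono) auto
    also have "\<dots> = a n powr p + (p / q) * t powr p"
      using pq by (simp add: distrib_left)
    finally show ?thesis using pq' by simp
  qed
  have g: "summable (\<lambda>n. \<alpha> ^ n)" "(1 - \<alpha>) * (\<Sum>n. \<alpha> ^ n) = 1"
    using \<alpha> by (auto simp: suminf_geometric)
  have "(\<Sum>n. p * t powr (p - 1) * (\<alpha> ^ n * a n)) \<le>
      (\<Sum>n. \<alpha> ^ n * a n powr p + (p - 1) * t powr p * \<alpha> ^ n)"
  proof (rule suminf_le)
    fix n
    show "p * t powr (p - 1) * (\<alpha> ^ n * a n) \<le> \<alpha> ^ n * a n powr p + (p - 1) * t powr p * \<alpha> ^ n"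
      using mult_left_mono[OF tangent, of "\<alpha> ^ n" n] \<alpha> by (simp add: algebra_simps)
  qed (use sa sp g in \<open>auto intro!: summable_add summable_mult\<close>)
  also have "\<dots> = (\<Sum>n. \<alpha> ^ n * a n powr p) + (p - 1) * t powr p * (\<Sum>n. \<alpha> ^ n)"
    using sp g by (simp add: suminf_add[symmetric] summable_mult suminf_mult)
  finally have "(1 - \<alpha>) * (p * t powr (p - 1) * (\<Sum>n. \<alpha> ^ n * a n)) \<le>
      (1 - \<alpha>) * ((\<Sum>n. \<alpha> ^ n * a n powr p) + (p - 1) * t powr p * (\<Sum>n. \<alpha> ^ n))"
    using sa \<alpha> by (intro mult_left_mono) (auto simp: suminf_mult)
  also have "\<dots> = (1 - \<alpha>) * (\<Sum>n. \<alpha> ^ n * a n powr p) +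
      (p - 1) * t powr p * ((1 - \<alpha>) * (\<Sum>n. \<alpha> ^ n))"
    by (simp only: algebra_simps)
  also have "(1 - \<alpha>) * (p * t powr (p - 1) * (\<Sum>n. \<alpha> ^ n * a n)) = p * (t * t powr (p - 1))"
    by (simp add: t_def)
  finally have "p * t powr p \<le> (1 - \<alpha>) * (\<Sum>n. \<alpha> ^ n * a n powr p) + (p - 1) * t powr p"
    unfolding g(2) tp by simp
  then have "t powr p \<le> (1 - \<alpha>) * (\<Sum>n. \<alpha> ^ n * a n powr p)"
    by (simp add: left_diff_distrib)
  then show ?thesis by (simp only: t_def)
qed

text \<open>Tonelli: the extended-real sum has a finite integral, hence is finite almost
  everywhere.\<close>

lemma AE_summable_of_summable_integral:
  fixes f :: "nat \<Rightarrow> 'a \<Rightarrow> real"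
  assumes f: "\<And>n. integrable M (f n)" and nn: "\<And>n x. 0 \<le> f n x"
    and s: "summable (\<lambda>n. \<integral>x. f n x \<partial>M)"
  shows "AE x in M. summable (\<lambda>n. f n x)"
proof -
  have [measurable]: "f n \<in> borel_measurable M" for n using f by auto
  have "(\<integral>\<^sup>+x. (\<Sum>n. ennreal (f n x)) \<partial>M) = (\<Sum>n. \<integral>\<^sup>+x. ennreal (f n x) \<partial>M)"
    by (rule nn_integral_suminf) simp
  also have "\<dots> = (\<Sum>n. ennreal (\<integral>x. f n x \<partial>M))"
    using f nn by (simp add: nn_integral_eq_integral)
  also have "\<dots> \<noteq> \<infinity>"
    using s nn by (simp add: suminf_ennreal2)
  finally have "AE x in M. (\<Sum>n. ennreal (f n x)) \<noteq> \<infinity>"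
    by (intro nn_integral_PInf_AE) auto
  then show ?thesis
    using nn by (auto intro: summable_suminf_not_top)
qed

text \<open>The integrals are dominated by the geometric series with terms
  \<open>\<alpha> ^ n * C\<close>. Applied to p-th powers this puts the Neumann sum in L^p; applied
  to absolute values it permits termwise integration.\<close>

lemma integrable_geometric_suminf:
  fixes g :: "nat \<Rightarrow> 'a \<Rightarrow> real"
  assumes \<alpha>: "0 < \<alpha>" "\<alpha> < 1" and int: "\<And>n. integrable M (g n)"
    and nn: "\<And>n x. 0 \<le> g n x" and bd: "\<And>n. (\<integral>x. g n x \<partial>M) \<le> C"
  shows "AE x in M. summable (\<lambda>n. \<alpha> ^ n * g n x)"
    and "summable (\<lambda>n. \<integral>x. \<alpha> ^ n * g n x \<partial>M)"
    and "integrable M (\<lambda>x. \<Sum>n. \<alpha> ^ n * g n x)"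
proof -
  show s: "summable (\<lambda>n. \<integral>x. \<alpha> ^ n * g n x \<partial>M)"
  proof (rule summable_comparison_test)
    show "summable (\<lambda>n. \<alpha> ^ n * C)"
      using \<alpha> by (intro summable_mult2) simp
    show "\<exists>N. \<forall>n\<ge>N. norm (\<integral>x. \<alpha> ^ n * g n x \<partial>M) \<le> \<alpha> ^ n * C"
      using \<alpha> bd nn by (auto simp: abs_mult intro!: mult_left_mono)
  qed
  show ae: "AE x in M. summable (\<lambda>n. \<alpha> ^ n * g n x)"
    using \<alpha> int nn s by (intro AE_summable_of_summable_integral) auto
  show "integrable M (\<lambda>x. \<Sum>n. \<alpha> ^ n * g n x)"
    using \<alpha> int nn s ae by (intro integrable_suminf) (auto simp: abs_mult)
qed

section \<open>The resolvent equation\<close>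

locale Lp_contractive_perron_frobenius = finite_measure M
  for M :: "'a measure" +
  fixes S :: "'a \<Rightarrow> 'a" and P :: "('a \<Rightarrow> real) \<Rightarrow> 'a \<Rightarrow> real" and p q \<alpha> :: real
  assumes S: "S \<in> measurable M M"
    and pf: "perron_frobenius M S P"
    and pq: "1 < p" "1 < q" "1 / p + 1 / q = 1"
    and \<alpha>: "0 < \<alpha>" "\<alpha> < 1"
    and contr: "f \<in> Lp_fun M p \<Longrightarrow> P f \<in> Lp_fun M p \<and> Lp_norm M p (P f) \<le> Lp_norm M p f"
begin

lemma P_Lp: "f \<in> Lp_fun M p \<Longrightarrow> P f \<in> Lp_fun M p"
  and P_norm_le: "f \<in> Lp_fun M p \<Longrightarrow> Lp_norm M p (P f) \<le> Lp_norm M p f"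
  using contr by auto

lemma Lp_integrable: "f \<in> Lp_fun M p \<Longrightarrow> integrable M f"
  using Lp_fun_integrable pq by simp

lemma P_set_integral:
  assumes "integrable M f" "A \<in> sets M"
  shows "(LINT x:A|M. P f x) = (LINT x:(S -` A \<inter> space M)|M. f x)"
  using pf assms by (auto simp: perron_frobenius_def)

lemma P_diff_AE:
  assumes f: "integrable M f" and g: "integrable M g"
  shows "AE x in M. P (\<lambda>y. f y - g y) x = P f x - P g x"
proof -
  have "AE x in M. P (\<lambda>y. f y + (- 1) * g y) x = P f x + P (\<lambda>y. (- 1) * g y) x"
    using pf f g unfolding perron_frobenius_def by (metis integrable_mult_right)
  moreover have "AE x in M. P (\<lambda>y. (- 1) * g y) x = (- 1) * P g x"
    using pf g unfolding perron_frobenius_def by blast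
  ultimately show ?thesis
    by eventually_elim simp
qed

section \<open>Bounds for the bilinear form\<close>

lemma pf_bilinear_eq:
  assumes "u \<in> Lp_fun M p" "v \<in> Lp_fun M q"
  shows "pf_bilinear M \<alpha> P u v = (\<integral>x. u x * v x \<partial>M) - \<alpha> * (\<integral>x. P u x * v x \<partial>M)"
proof -
  have "pf_bilinear M \<alpha> P u v = (\<integral>x. u x * v x - \<alpha> * (P u x * v x) \<partial>M)"
    by (simp add: pf_bilinear_def algebra_simps)
  also have "\<dots> = (\<integral>x. u x * v x \<partial>M) - \<alpha> * (\<integral>x. P u x * v x \<partial>M)"
    using Holder_inequality(1)[OF pq assms] Holder_inequality(1)[OF pq P_Lp[OF assms(1)] assms(2)]
    by simp
  finally show ?thesis .
qed

text \<open>Passes from the pointwise equation to the weak one, both for existence and for adjoint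
  injectivity.\<close>

lemma pf_bilinear_cong_AE:
  assumes u: "u \<in> Lp_fun M p" and h: "h \<in> Lp_fun M p" and v: "v \<in> Lp_fun M q"
    and "AE x in M. u x - \<alpha> * P u x = h x"
  shows "pf_bilinear M \<alpha> P u v = (\<integral>x. h x * v x \<partial>M)"
proof -
  note [measurable] = Lp_funD(1)[OF u] Lp_funD(1)[OF h] Lp_funD(1)[OF v] Lp_funD(1)[OF P_Lp[OF u]]
  show ?thesis
    unfolding pf_bilinear_def using assms(4) by (intro integral_cong_AE) auto
qed

lemma abs_integral_P_mult_le:
  assumes u: "u \<in> Lp_fun M p" and v: "v \<in> Lp_fun M q"
  shows "\<bar>\<integral>x. P u x * v x \<partial>M\<bar> \<le> Lp_norm M p u * Lp_norm M q v"
  using Holder_inequality(2)[OF pq P_Lp[OF u] v]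
    mult_right_mono[OF P_norm_le[OF u] Lp_norm_nonneg[of M q v]]
  by linarith

lemma abs_pf_bilinear_le:
  assumes u: "u \<in> Lp_fun M p" and v: "v \<in> Lp_fun M q"
  shows "\<bar>pf_bilinear M \<alpha> P u v\<bar> \<le> (1 + \<alpha>) * Lp_norm M p u * Lp_norm M q v"
proof -
  have "\<bar>pf_bilinear M \<alpha> P u v\<bar> \<le> \<bar>\<integral>x. u x * v x \<partial>M\<bar> + \<alpha> * \<bar>\<integral>x. P u x * v x \<partial>M\<bar>"
    unfolding pf_bilinear_eq[OF u v]
    using \<alpha> abs_triangle_ineq4[of "\<integral>x. u x * v x \<partial>M" "\<alpha> * (\<integral>x. P u x * v x \<partial>M)"]
    by (simp only: abs_mult abs_of_pos)
  also have "\<dots> \<le> Lp_norm M p u * Lp_norm M q v + \<alpha> * (Lp_norm M p u * Lp_norm M q v)"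
    using Holder_inequality(2)[OF pq u v] abs_integral_P_mult_le[OF u v] \<alpha>
    by (intro add_mono mult_left_mono) auto
  finally show ?thesis by (simp add: algebra_simps)
qed

text \<open>The identity part attains equality in Hoelder, and the \<open>P\<close> part takes away
  at most the fraction \<open>\<alpha>\<close>. This plays the role of coercivity in both inf-sup
  stability and uniqueness.\<close>

lemma pf_bilinear_duality_map_ge:
  assumes u: "u \<in> Lp_fun M p"
  shows "pf_bilinear M \<alpha> P u (duality_map p u) \<ge>
    (1 - \<alpha>) * Lp_norm M p u * Lp_norm M q (duality_map p u)"
proof -
  let ?v = "duality_map p u"
  have v: "?v \<in> Lp_fun M q"
    using pq u by (intro duality_map_Lp_fun)
  have "\<alpha> * (\<integral>x. P u x * ?v x \<partial>M) \<le> \<alpha> * (Lp_norm M p u * Lp_norm M q ?v)"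
    using abs_integral_P_mult_le[OF u v] \<alpha> by (intro mult_left_mono) auto
  moreover have "(\<integral>x. u x * ?v x \<partial>M) = Lp_norm M p u * Lp_norm M q ?v"
    using pq by (simp add: mult_duality_map Lp_norm_duality_map)
  ultimately show ?thesis
    unfolding pf_bilinear_eq[OF u v] by (simp add: algebra_simps)
qed

lemma inf_sup_stability:
  assumes u: "u \<in> Lp_fun M p"
  shows "Lq_sup_quotient M q (pf_bilinear M \<alpha> P u) \<ge> ereal ((1 - \<alpha>) * Lp_norm M p u)"
proof -
  define V where "V = {v \<in> Lp_fun M q. \<not> (AE x in M. v x = 0)}"
  let ?v = "duality_map p u"
  have v: "?v \<in> Lp_fun M q"
    using pq u by (intro duality_map_Lp_fun)
  have pos: "0 < Lp_norm M q w" if "w \<in> V" for w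
    using that Lp_norm_zero_AE[of w M q] Lp_norm_nonneg[of M q w] pq
    by (auto simp: V_def less_le)
  \<comment> \<open>A single admissible test function attaining the bound suffices; which one
    depends on whether \<open>u\<close> vanishes.\<close>
  have witness: ?thesis if "w \<in> V"
    and "pf_bilinear M \<alpha> P u w \<ge> (1 - \<alpha>) * Lp_norm M p u * Lp_norm M q w" for w
  proof -
    have "(1 - \<alpha>) * Lp_norm M p u \<le> pf_bilinear M \<alpha> P u w / Lp_norm M q w"
      using that pos by (simp add: pos_le_divide_eq)
    then have "ereal ((1 - \<alpha>) * Lp_norm M p u) \<le>
        (SUP v\<in>V. ereal (pf_bilinear M \<alpha> P u v / Lp_norm M q v))"
      using that(1) by (intro SUP_upper2[of w]) auto
    then show ?thesis
      using that(1) by (auto simp: Lq_sup_quotient_def V_def[symmetric] Let_def)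
  qed
  show ?thesis
  proof (cases "Lp_norm M p u = 0")
    case True
    show ?thesis
    \<comment> \<open>For \<open>u\<close> of norm zero the duality map is not admissible. Any other
      element of \<open>V\<close> gives quotient 0, and for empty \<open>V\<close> the convention in
      \<open>Lq_sup_quotient\<close> gives 0.\<close>
    proof (cases "V = {}")
      case False
      then obtain w where w: "w \<in> V" by auto
      then have "pf_bilinear M \<alpha> P u w = 0"
        using abs_pf_bilinear_le[OF u, of w] True by (simp add: V_def)
      then show ?thesis using witness[OF w] True by simp
    qed (simp add: Lq_sup_quotient_def V_def[symmetric] True)
  next
    case False
    have "\<not> (AE x in M. ?v x = 0)"
    proof
      assume "AE x in M. ?v x = 0"
      then have "(\<integral>x. u x * ?v x \<partial>M) = 0"
        by (intro integral_eq_zero_AE) auto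
      then have "Lp_norm M p u powr p = 0"
        using pq by (simp add: mult_duality_map Lp_norm_powr)
      then show False using False by simp
    qed
    then have "?v \<in> V" using v by (simp add: V_def)
    then show ?thesis using witness pf_bilinear_duality_map_ge[OF u] by blast
  qed
qed

section \<open>Existence by the Neumann series\<close>

text \<open>\<open>P\<close> is never interchanged with the infinite sum. Its defining identity
  moves set integrals to the preimage, where the series is integrated term by term.\<close>

lemma resolvent_exists:
  assumes g: "g \<in> Lp_fun M p"
  shows "\<exists>u\<in>Lp_fun M p. AE x in M. u x - \<alpha> * P u x = g x"
proof -
  define G where "G n = (P ^^ n) g" for n
  have G0: "G 0 = g" and GS: "G (Suc n) = P (G n)" for n
    by (auto simp: G_def)
  have G: "G n \<in> Lp_fun M p" for n
    by (induction n) (auto simp: G0 GS g P_Lp)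
  have "Lp_norm M p (G n) \<le> Lp_norm M p g" for n
  proof (induction n)
    case (Suc n)
    then show ?case using P_norm_le[OF G, of n] by (simp add: GS)
  qed (simp add: G0)
  then have "(\<integral>x. \<bar>G n x\<bar> powr p \<partial>M) \<le> Lp_norm M p g powr p" for n
    using pq Lp_norm_powr[of p M "G n"] powr_mono2[of p "Lp_norm M p (G n)" "Lp_norm M p g"]
    by (simp add: Lp_norm_nonneg)
  note geop = integrable_geometric_suminf[of \<alpha> M "\<lambda>n x. \<bar>G n x\<bar> powr p",
      OF \<alpha> Lp_funD(2)[OF G] powr_ge_zero this]
  have intG: "integrable M (G n)" for n
    using G by (rule Lp_integrable)
  have "(\<integral>x. \<bar>G n x\<bar> \<partial>M) \<le> (\<integral>x. 1 + \<bar>G n x\<bar> powr p \<partial>M)" for n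
    using intG Lp_funD(2)[OF G] abs_le_one_add_powr pq by (intro integral_mono) auto
  also have "(\<integral>x. 1 + \<bar>G n x\<bar> powr p \<partial>M) \<le> measure M (space M) + Lp_norm M p g powr p" for n
    using Lp_funD(2)[OF G] \<open>(\<integral>x. \<bar>G n x\<bar> powr p \<partial>M) \<le> Lp_norm M p g powr p\<close> by simp
  finally have bd1: "(\<integral>x. \<bar>G n x\<bar> \<partial>M) \<le> measure M (space M) + Lp_norm M p g powr p" for n .
  note geo1 = integrable_geometric_suminf[of \<alpha> M "\<lambda>n x. \<bar>G n x\<bar>",
      OF \<alpha> integrable_abs[OF intG] abs_ge_zero bd1]

  \<comment> \<open>Where the series diverges, \<open>suminf\<close> is an arbitrary value; this
    happens only on a null set and affects neither integrals nor almost-everywhere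
    statements.\<close>
  define u where "u x = (\<Sum>n. \<alpha> ^ n * G n x)" for x
  have [measurable]: "G n \<in> borel_measurable M" for n
    using intG by auto
  have [measurable]: "u \<in> borel_measurable M"
    unfolding u_def by measurable
  have u: "u \<in> Lp_fun M p"
  proof -
    \<comment> \<open>The factor \<open>1 - \<alpha>\<close> turns the weights into probabilities
      for Jensen's inequality; it is divided out at the end.\<close>
    have "integrable M (\<lambda>x. \<bar>(1 - \<alpha>) * u x\<bar> powr p)"
    proof (rule Bochner_Integration.integrable_bound)
      show "integrable M (\<lambda>x. (1 - \<alpha>) * (\<Sum>n. \<alpha> ^ n * \<bar>G n x\<bar> powr p))"
        using geop(3) by simp
      show "AE x in M. norm (\<bar>(1 - \<alpha>) * u x\<bar> powr p) \<le>
          norm ((1 - \<alpha>) * (\<Sum>n. \<alpha> ^ n * \<bar>G n x\<bar> powr p))"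
        using geop(1) geo1(1)
      proof eventually_elim
        case (elim x)
        have "\<bar>u x\<bar> \<le> (\<Sum>n. \<alpha> ^ n * \<bar>G n x\<bar>)"
          unfolding u_def using elim(2) \<alpha> summable_rabs[of "\<lambda>n. \<alpha> ^ n * G n x"]
          by (simp add: abs_mult)
        then have "\<bar>(1 - \<alpha>) * u x\<bar> powr p \<le> ((1 - \<alpha>) * (\<Sum>n. \<alpha> ^ n * \<bar>G n x\<bar>)) powr p"
          using \<alpha> pq by (intro powr_mono2) (auto simp: abs_mult)
        also have "\<dots> \<le> (1 - \<alpha>) * (\<Sum>n. \<alpha> ^ n * \<bar>G n x\<bar> powr p)"
          using elim by (intro powr_geometric_suminf_le[OF pq \<alpha>]) auto
        finally show ?case by simp
      qed
    qed simp
    moreover have "(\<lambda>x. (1 - \<alpha>) * u x) \<in> borel_measurable M"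
      by measurable
    ultimately have "(\<lambda>x. (1 - \<alpha>) * u x) \<in> Lp_fun M p"
      unfolding Lp_fun_def by blast
    then have "(\<lambda>x. inverse (1 - \<alpha>) * ((1 - \<alpha>) * u x)) \<in> Lp_fun M p"
      by (rule Lp_fun_cmult)
    then show ?thesis using \<alpha> by (simp add: mult.assoc[symmetric])
  qed

  \<comment> \<open>Termwise integration over \<open>A\<close>, justified by the integrable majorant
    from \<open>geo1\<close>.\<close>
  have series: "(\<lambda>n. \<alpha> ^ n * (LINT x:A|M. G n x)) sums (LINT x:A|M. u x)"
    if A: "A \<in> sets M" for A
  proof -
    let ?f = "\<lambda>n x. indicator A x * (\<alpha> ^ n * G n x)"
    have f: "integrable M (?f n)" for n
      using integrable_mult_indicator[OF A, of "\<lambda>x. \<alpha> ^ n * G n x"] intG by simp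
    have le: "norm (?f n x) \<le> \<alpha> ^ n * \<bar>G n x\<bar>" for n x
      using \<alpha> by (auto simp: indicator_def abs_mult)
    have "(\<lambda>n. integral\<^sup>L M (?f n)) sums (\<integral>x. (\<Sum>n. ?f n x) \<partial>M)"
    proof (rule sums_integral)
      show "AE x in M. summable (\<lambda>n. norm (?f n x))"
        using geo1(1)
        by eventually_elim (rule summable_comparison_test', assumption, use le in auto)
      show "summable (\<lambda>n. \<integral>x. norm (?f n x) \<partial>M)"
      proof (rule summable_comparison_test'[OF geo1(2), of 0])
        fix n
        have "(\<integral>x. norm (?f n x) \<partial>M) \<le> (\<integral>x. \<alpha> ^ n * \<bar>G n x\<bar> \<partial>M)"
          by (intro integral_mono integrable_norm f le integrable_mult_right integrable_abs intG)
        then show "norm (\<integral>x. norm (?f n x) \<partial>M) \<le> (\<integral>x. \<alpha> ^ n * \<bar>G n x\<bar> \<partial>M)"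
          by (simp only: real_norm_def abs_of_nonneg[OF Bochner_Integration.integral_nonneg] abs_ge_zero)
      qed
    qed (rule f)
    moreover have "integral\<^sup>L M (?f n) = \<alpha> ^ n * (LINT x:A|M. G n x)" for n
      unfolding set_lebesgue_integral_def
      by (subst mult.left_commute) (simp only: integral_mult_right_zero real_scaleR_def)
    moreover have "(\<integral>x. (\<Sum>n. ?f n x) \<partial>M) = (LINT x:A|M. u x)"
      unfolding set_lebesgue_integral_def u_def
      by (intro Bochner_Integration.integral_cong) (auto simp: indicator_def)
    ultimately show ?thesis by simp
  qed

  have "AE x in M. u x - \<alpha> * P u x = g x"
  \<comment> \<open>Two integrable functions with equal integrals over all measurable sets agree
    almost everywhere.\<close>
  proof (rule density_unique_real)
    fix A assume A: "A \<in> sets M"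
    have A': "S -` A \<inter> space M \<in> sets M"
      using S A by (rule measurable_sets)
    have "(\<lambda>n. \<alpha> * (\<alpha> ^ n * (LINT x:(S -` A \<inter> space M)|M. G n x))) sums
        (\<alpha> * (LINT x:(S -` A \<inter> space M)|M. u x))"
      by (intro sums_mult series A')
    \<comment> \<open>Returning from the preimage to \<open>A\<close> applies \<open>P\<close> to
      each term and to \<open>u\<close>, which shifts the index of the iterates by one.\<close>
    then have "(\<lambda>n. \<alpha> ^ Suc n * (LINT x:A|M. G (Suc n) x)) sums (\<alpha> * (LINT x:A|M. P u x))"
      using P_set_integral[OF intG A] P_set_integral[OF Lp_integrable[OF u] A]
      by (simp add: GS mult.assoc)
    \<comment> \<open>The shifted series is the original one over \<open>A\<close> without its term
      at n = 0, the integral of \<open>g\<close>.\<close>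
    moreover have "(\<lambda>n. \<alpha> ^ Suc n * (LINT x:A|M. G (Suc n) x)) sums
        ((LINT x:A|M. u x) - (LINT x:A|M. g x))"
      using series[OF A] by (subst sums_Suc_iff) (simp add: G0)
    ultimately have eq: "\<alpha> * (LINT x:A|M. P u x) = (LINT x:A|M. u x) - (LINT x:A|M. g x)"
      by (rule sums_unique2)
    have si: "set_integrable M A f" if "f \<in> Lp_fun M p" for f
      using integrable_mult_indicator[OF A Lp_integrable[OF that]] by (simp add: set_integrable_def)
    have "(LINT x:A|M. u x - \<alpha> * P u x) = (LINT x:A|M. u x) - \<alpha> * (LINT x:A|M. P u x)"
      using si[OF u] si[OF P_Lp[OF u]] by simp
    then show "(LINT x:A|M. u x - \<alpha> * P u x) = (LINT x:A|M. g x)"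
      using eq by simp
  qed (use Lp_integrable u g P_Lp in auto)
  then show ?thesis using u by blast
qed

section \<open>Adjoint injectivity and uniqueness\<close>

text \<open>The exponents swap roles: the duality map of \<open>v\<close> lies in L^p, so it is
  \<open>u - \<alpha> P u\<close> for some \<open>u\<close>. Testing with that \<open>u\<close>
  turns the hypothesis into a vanishing integral of \<open>\<bar>v\<bar> powr q\<close>.\<close>

lemma adjoint_injective:
  assumes v: "v \<in> Lp_fun M q" and zero: "\<And>u. u \<in> Lp_fun M p \<Longrightarrow> pf_bilinear M \<alpha> P u v = 0"
  shows "AE x in M. v x = 0"
proof -
  have qp: "1 / q + 1 / p = 1" using pq by simp
  have h: "duality_map q v \<in> Lp_fun M p"
    using pq qp v by (intro duality_map_Lp_fun)
  obtain u where u: "u \<in> Lp_fun M p" "AE x in M. u x - \<alpha> * P u x = duality_map q v x"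
    using resolvent_exists[OF h] by blast
  have "Lp_norm M q v powr q = (\<integral>x. duality_map q v x * v x \<partial>M)"
    using pq by (simp add: Lp_norm_powr mult_duality_map mult.commute)
  also have "\<dots> = 0"
    using pf_bilinear_cong_AE[OF u(1) h v u(2)] zero[OF u(1)] by simp
  finally show ?thesis
    using Lp_norm_zero_AE[OF v] pq by simp
qed

text \<open>The difference is tested against its own duality map, where the lower bound on the form
  forces its norm to vanish.\<close>

lemma weak_solution_unique:
  assumes u: "u \<in> Lp_fun M p" and w: "w \<in> Lp_fun M p"
    and eq: "\<And>v. v \<in> Lp_fun M q \<Longrightarrow> pf_bilinear M \<alpha> P u v = pf_bilinear M \<alpha> P w v"
  shows "AE x in M. u x = w x"
proof -
  let ?d = "\<lambda>x. u x - w x"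
  let ?v = "duality_map p ?d"
  have d: "?d \<in> Lp_fun M p"
    using Lp_fun_add[OF u Lp_fun_cmult[OF w, of "- 1"]] pq by simp
  have v: "?v \<in> Lp_fun M q"
    using pq d by (intro duality_map_Lp_fun)
  note [measurable] = Lp_funD(1)[OF u] Lp_funD(1)[OF w] Lp_funD(1)[OF v]
    Lp_funD(1)[OF P_Lp[OF u]] Lp_funD(1)[OF P_Lp[OF w]] Lp_funD(1)[OF P_Lp[OF d]]
  \<comment> \<open>\<open>P\<close> is linear only up to null sets, so linearity is used under the
    integral.\<close>
  have "(\<integral>x. P ?d x * ?v x \<partial>M) = (\<integral>x. P u x * ?v x - P w x * ?v x \<partial>M)"
    using P_diff_AE[OF Lp_integrable[OF u] Lp_integrable[OF w]]
    by (intro integral_cong_AE) (auto simp: left_diff_distrib)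
  also have "\<dots> = (\<integral>x. P u x * ?v x \<partial>M) - (\<integral>x. P w x * ?v x \<partial>M)"
    using u w v by (intro Bochner_Integration.integral_diff Holder_inequality(1)[OF pq] P_Lp)
  finally have "(\<integral>x. P ?d x * ?v x \<partial>M) = \<dots>" .
  moreover have "(\<integral>x. ?d x * ?v x \<partial>M) = (\<integral>x. u x * ?v x \<partial>M) - (\<integral>x. w x * ?v x \<partial>M)"
    unfolding left_diff_distrib
    using u w v by (intro Bochner_Integration.integral_diff Holder_inequality(1)[OF pq])
  ultimately have "pf_bilinear M \<alpha> P ?d ?v = 0"
    using eq[OF v] unfolding pf_bilinear_eq[OF u v] pf_bilinear_eq[OF w v] pf_bilinear_eq[OF d v]
    by (simp only: right_diff_distrib)
  then have "(1 - \<alpha>) * (Lp_norm M p ?d * Lp_norm M q ?v) \<le> 0"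
    using pf_bilinear_duality_map_ge[OF d] by (simp add: mult.assoc)
  \<comment> \<open>The product of the two norms is the p-th power of the norm of the difference,
    and \<open>1 - \<alpha>\<close> is positive.\<close>
  then have "Lp_norm M p ?d powr p \<le> 0"
    using pq \<alpha> by (simp add: Lp_norm_duality_map Lp_norm_powr mult_le_0_iff)
  then have "Lp_norm M p ?d = 0"
    using powr_ge_zero[of "Lp_norm M p ?d" p] by simp
  then show ?thesis
    using Lp_norm_zero_AE[OF d] pq by simp
qed

end

section \<open>Specialisation to Lebesgue measure on a bounded Borel set\<close>

theorem theorem5:
  fixes \<Omega> :: "'a::euclidean_space set"
    and M :: "'a measure"
    and S :: "'a \<Rightarrow> 'a"
    and P :: "('a \<Rightarrow> real) \<Rightarrow> 'a \<Rightarrow> real"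
    and f0 :: "'a \<Rightarrow> real"
    and p q \<alpha> :: real
  defines "M \<equiv> restrict_space lborel \<Omega>"
  assumes "\<Omega> \<in> sets borel" and "bounded \<Omega>"
    and "nonsingular_map M S"
    and "perron_frobenius M S P"
    and "1 < p" and "1 < q" and "1 / p + 1 / q = 1"
    and "0 < \<alpha>" and "\<alpha> < 1"
    and "f0 \<in> Lp_fun M p" and "AE x in M. 0 \<le> f0 x"
    and "\<And>f. f \<in> Lp_fun M p \<Longrightarrow> P f \<in> Lp_fun M p \<and> Lp_norm M p (P f) \<le> Lp_norm M p f"
  shows
    "(\<forall>u\<in>Lp_fun M p. \<forall>v\<in>Lp_fun M q.
        \<bar>pf_bilinear M \<alpha> P u v\<bar> \<le> (1 + \<alpha>) * Lp_norm M p u * Lp_norm M q v) \<and>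
     (\<forall>v\<in>Lp_fun M q. \<bar>pf_linear M f0 v\<bar> \<le> Lp_norm M p f0 * Lp_norm M q v) \<and>
     (\<forall>u\<in>Lp_fun M p.
        Lq_sup_quotient M q (pf_bilinear M \<alpha> P u) \<ge> ereal ((1 - \<alpha>) * Lp_norm M p u)) \<and>
     (\<forall>v\<in>Lp_fun M q. (\<forall>u\<in>Lp_fun M p. pf_bilinear M \<alpha> P u v = 0) \<longrightarrow> (AE x in M. v x = 0)) \<and>
     (\<exists>u\<in>Lp_fun M p. (\<forall>v\<in>Lp_fun M q. pf_bilinear M \<alpha> P u v = pf_linear M f0 v) \<and>
        (\<forall>u'\<in>Lp_fun M p. (\<forall>v\<in>Lp_fun M q. pf_bilinear M \<alpha> P u' v = pf_linear M f0 v) \<longrightarrow>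
           (AE x in M. u' x = u x)))"
proof -
  have "finite_measure M"
  proof
    have "emeasure M (space M) = emeasure lborel \<Omega>"
      using assms(2) by (simp add: M_def emeasure_restrict_space space_restrict_space)
    also have "\<dots> < \<infinity>"
      using assms(3) by (rule emeasure_bounded_finite)
    finally show "emeasure M (space M) \<noteq> \<infinity>" by simp
  qed
  then interpret Lp_contractive_perron_frobenius M S P p q \<alpha>
    using assms(4-)
    by (auto simp: Lp_contractive_perron_frobenius_def Lp_contractive_perron_frobenius_axioms_def
        nonsingular_map_def)
  have f0: "f0 \<in> Lp_fun M p" by fact
  \<comment> \<open>A pointwise solution with right-hand side \<open>f0\<close> is the required weak
    solution.\<close>
  obtain u where u: "u \<in> Lp_fun M p" "AE x in M. u x - \<alpha> * P u x = f0 x"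
    using resolvent_exists[OF f0] by blast
  have sol: "pf_bilinear M \<alpha> P u v = pf_linear M f0 v" if "v \<in> Lp_fun M q" for v
    using pf_bilinear_cong_AE[OF u(1) f0 that u(2)] by (simp add: pf_linear_def)
  show ?thesis
  proof (intro conjI)
    show "\<forall>v\<in>Lp_fun M q. \<bar>pf_linear M f0 v\<bar> \<le> Lp_norm M p f0 * Lp_norm M q v"
      unfolding pf_linear_def using Holder_inequality(2)[OF pq f0] by blast
    show "\<forall>v\<in>Lp_fun M q. (\<forall>u\<in>Lp_fun M p. pf_bilinear M \<alpha> P u v = 0) \<longrightarrow> (AE x in M. v x = 0)"
      using adjoint_injective by blast
    show "\<exists>u\<in>Lp_fun M p. (\<forall>v\<in>Lp_fun M q. pf_bilinear M \<alpha> P u v = pf_linear M f0 v) \<and>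
        (\<forall>u'\<in>Lp_fun M p. (\<forall>v\<in>Lp_fun M q. pf_bilinear M \<alpha> P u' v = pf_linear M f0 v) \<longrightarrow>
           (AE x in M. u' x = u x))"
    proof (intro bexI[of _ u] conjI ballI impI sol u(1))
      fix w assume "w \<in> Lp_fun M p" "\<forall>v\<in>Lp_fun M q. pf_bilinear M \<alpha> P w v = pf_linear M f0 v"
      then show "AE x in M. w x = u x"
        using sol by (intro weak_solution_unique[OF _ u(1)]) auto
    qed
  qed (use abs_pf_bilinear_le inf_sup_stability in blast)+
qed

end
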